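(* Let $n\ge1$. Up to the identification of symbols that are equal almost everywhere, the left and right $\mathrm{U}(n)$-invariant symbols are given as follows: $$L^\infty(\mathrm{D}^{\mathrm{I}}_{n\times n})^{\mathrm{U}(n)_L}=\{a\in L^\infty(\mathrm{D}^{\mathrm{I}}_{n\times n})\mid a(Z)=a\big((Z^*Z)^{\frac12}\big)\text{ for every }Z\in\mathrm{D}^{\mathrm{I}}_{n\times n}\},$$ $$L^\infty(\mathrm{D}^{\mathrm{I}}_{n\times n})^{\mathrm{U}(n)_R}=\{a\in L^\infty(\mathrm{D}^{\mathrm{I}}_{n\times n})\mid a(Z)=a\big((ZZ^* )^{\frac12}\big)\text{ for every }Z\in\mathrm{D}^{\mathrm{I}}_{n\times n}\}.$$
   Context: $\mathrm{D}^{\mathrm{I}}_{n\times n}=\{Z\in M_{n\times n}(\mathbb{C}): Z^*Z<I_n\}$. A symbol is a measurable, essentially bounded function on $\mathrm{D}^{\mathrm{I}}_{n\times n}$. $L^\infty(\mathrm{D}^{\mathrm{I}}_{n\times n})^{\mathrm{U}(n)_L}$ is the space of left $\mathrm{U}(n)$-invariant symbols: $a(UZ)=a(Z)$ for every $U\in\mathrm{U}(n)$, $Z\in\mathrm{D}^{\mathrm{I}}_{n\times n}$. $L^\infty(\mathrm{D}^{\mathrm{I}}_{n\times n})^{\mathrm{U}(n)_R}$ is the space of right $\mathrm{U}(n)$-invariant symbols: $a(ZV)=a(Z)$ for every $V\in\mathrm{U}(n)$, $Z\in\mathrm{D}^{\mathrm{I}}_{n\times n}$. The equalities are between the corresponding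 sets of almost-everywhere equivalence classes, each defining condition being required of some everywhere-defined representative of the class. *)

theory Defs
  imports "HOL-Analysis.Analysis"
begin

definition conj_transpose :: "complex^'n^'m \<Rightarrow> complex^'m^'n" where
  "conj_transpose A = (\<chi> i j. cnj (A $ j $ i))"

definition sesq_form :: "complex^'n^'n \<Rightarrow> complex^'n \<Rightarrow> complex" where
  "sesq_form A x = (\<Sum>i\<in>UNIV. cnj (x $ i) * (A *v x) $ i)"

text \<open>For Hermitian matrices the values of \<^const>\<open>sesq_form\<close> are real, so only
  their real parts need to be compared with zero.\<close>

definition hermitian_matrix :: "complex^'n^'n \<Rightarrow> bool" where
  "hermitian_matrix A \<longleftrightarrow> conj_transpose A = A"

definition pos_semidef :: "complex^'n^'n \<Rightarrow> bool" where
  "pos_semidef A \<longleftrightarrow> hermitian_matrix A \<and> (\<forall>x. 0 \<le> Re (sesq_form A x))"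

definition pos_def :: "complex^'n^'n \<Rightarrow> bool" where
  "pos_def A \<longleftrightarrow> hermitian_matrix A \<and> (\<forall>x. x \<noteq> 0 \<longrightarrow> 0 < Re (sesq_form A x))"

definition loewner_less :: "complex^'n^'n \<Rightarrow> complex^'n^'n \<Rightarrow> bool" where
  "loewner_less A B \<longleftrightarrow> pos_def (B - A)"

text \<open>Meaningful for positive semidefinite \<open>A\<close>, where exactly one such \<open>B\<close> exists.\<close>

definition matrix_sqrt :: "complex^'n^'n \<Rightarrow> complex^'n^'n" where
  "matrix_sqrt A = (THE B. pos_semidef B \<and> B ** B = A)"

definition unitary_group :: "(complex^'n^'n) set" where
  "unitary_group = {U. conj_transpose U ** U = mat 1 \<and> U ** conj_transpose U = mat 1}"

definition cartan_domain_I :: "(complex^'n^'n) set" where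
  "cartan_domain_I = {Z. loewner_less (conj_transpose Z ** Z) (mat 1)}"

text \<open>Symbols are represented by total functions; their values outside the domain are
  irrelevant and are identified by \<open>ae_eq_symbols\<close>. The reference measure is Lebesgue measure.\<close>

definition symbols :: "(complex^'n^'n \<Rightarrow> complex) set" where
  "symbols = {a \<in> borel_measurable (lebesgue_on cartan_domain_I).
     \<exists>C. AE Z in lebesgue_on cartan_domain_I. norm (a Z) \<le> C}"

definition ae_eq_symbols :: "((complex^'n^'n \<Rightarrow> complex) \<times> (complex^'n^'n \<Rightarrow> complex)) set" where
  "ae_eq_symbols = {(a, b). a \<in> symbols \<and> b \<in> symbols \<and>
     (AE Z in lebesgue_on cartan_domain_I. a Z = b Z)}"

definition Linf :: "(complex^'n^'n \<Rightarrow> complex) set set" where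
  "Linf = symbols // ae_eq_symbols"

text \<open>Invariance is required everywhere on the domain, for some representative of the class.\<close>

definition Linf_left_inv :: "(complex^'n^'n \<Rightarrow> complex) set set" where
  "Linf_left_inv = {c \<in> Linf. \<exists>a\<in>c. \<forall>U\<in>unitary_group. \<forall>Z\<in>cartan_domain_I. a (U ** Z) = a Z}"

definition Linf_right_inv :: "(complex^'n^'n \<Rightarrow> complex) set set" where
  "Linf_right_inv = {c \<in> Linf. \<exists>a\<in>c. \<forall>V\<in>unitary_group. \<forall>Z\<in>cartan_domain_I. a (Z ** V) = a Z}"

end

theory Submission
  imports Defs
begin

text \<open>
  Invariance of a representative \<open>a\<close> and dependence of \<open>a\<close> on the positive root alone are equivalent
  pointwise, so the same representative witnesses both sides.  If \<open>a\<close> satisfies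
  \<open>a Z = a ((Z\<^sup>* Z)\<^sup>1\<^sup>/\<^sup>2)\<close>, it is left invariant because \<open>(U Z)\<^sup>* (U Z) = Z\<^sup>* Z\<close> for unitary \<open>U\<close>.
  Conversely, a polar decomposition \<open>Z = U P\<close> with \<open>P = (Z\<^sup>* Z)\<^sup>1\<^sup>/\<^sup>2\<close> turns left invariance into
  \<open>a Z = a (U P) = a P\<close>.  On the right one writes the same decomposition as \<open>Z = (U P U\<^sup>*) U\<close>,
  where \<open>U P U\<^sup>*\<close> is the positive root of \<open>Z Z\<^sup>*\<close>.

  The mathematical content is therefore the polar decomposition of an arbitrary, possibly singular,
  square matrix, together with the uniqueness of the positive square root.

  For the decomposition (\<open>polar_decomposition\<close>), let \<open>U\<close> maximise the real inner product
  \<open>U \<bullet> Z = Re (tr (U\<^sup>* Z))\<close> over the compact unitary group and put \<open>P = U\<^sup>* Z\<close>.  Maximality says that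
  \<open>Re (tr (V\<^sup>* P)) \<le> Re (tr P)\<close> for every unitary \<open>V\<close>.  Testing with the matrices \<open>V\<close> that multiply
  one line \<open>\<complex>x\<close> by a unimodular scalar and fix its orthogonal complement shows that
  \<open>\<langle>x, P x\<rangle>\<close> is real and nonnegative for every \<open>x\<close>, and a complex matrix with this property is
  Hermitian by polarisation.

  For uniqueness (\<open>pos_semidef_root_unique\<close>), let \<open>P\<^sup>2 = Q\<^sup>2\<close>, \<open>D = P - Q\<close> and \<open>S = P + Q\<close>.  Then
  \<open>S D + D S = 0\<close>, hence \<open>tr (D S D) = 0\<close>; since \<open>D S D\<close> is a sum of the positive matrices \<open>D P D\<close>
  and \<open>D Q D\<close>, both \<open>P D\<close> and \<open>Q D\<close> vanish, so \<open>D\<^sup>2 = 0\<close>,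
  and \<open>D = 0\<close> because \<open>D\<close> is Hermitian.
\<close>

section \<open>The Hermitian inner product and adjoints\<close>

definition herm_inner :: "complex^'n \<Rightarrow> complex^'n \<Rightarrow> complex" where
  "herm_inner x y = (\<Sum>i\<in>UNIV. cnj (x $ i) * y $ i)"

lemma sesq_form_eq_herm_inner: "sesq_form A x = herm_inner x (A *v x)"
  by (simp add: sesq_form_def herm_inner_def)

lemma Re_herm_inner: "Re (herm_inner x y) = x \<bullet> y"
  by (simp add: herm_inner_def inner_vec_def inner_complex_def)

lemma cnj_herm_inner: "cnj (herm_inner x y) = herm_inner y x"
  by (simp add: herm_inner_def mult.commute)

lemma herm_inner_add_right: "herm_inner x (y + z) = herm_inner x y + herm_inner x z"
  by (simp add: herm_inner_def algebra_simps sum.distrib)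

lemma herm_inner_add_left: "herm_inner (x + y) z = herm_inner x z + herm_inner y z"
  by (simp add: herm_inner_def algebra_simps sum.distrib)

lemma herm_inner_diff_right: "herm_inner x (y - z) = herm_inner x y - herm_inner x z"
  by (simp add: herm_inner_def algebra_simps sum_subtractf)

lemma herm_inner_self: "herm_inner x x = complex_of_real ((norm x)\<^sup>2)"
proof -
  have "Im (herm_inner x x) = 0"
    using cnj_herm_inner[of x x] by (simp add: complex_eq_iff)
  then show ?thesis
    by (simp add: complex_eq_iff Re_herm_inner power2_norm_eq_inner)
qed

lemma conj_transpose_conj_transpose [simp]: "conj_transpose (conj_transpose A) = A"
  by (simp add: conj_transpose_def vec_eq_iff)

lemma conj_transpose_mat_1 [simp]: "conj_transpose (mat 1) = mat 1"
  by (simp add: conj_transpose_def mat_def vec_eq_iff)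

lemma conj_transpose_diff: "conj_transpose (A - B) = conj_transpose A - conj_transpose B"
  by (simp add: conj_transpose_def vec_eq_iff)

lemma conj_transpose_mult: "conj_transpose (A ** B) = conj_transpose B ** conj_transpose A"
  by (simp add: conj_transpose_def matrix_matrix_mult_def vec_eq_iff mult.commute)

lemma herm_inner_adjoint: "herm_inner x (A *v y) = herm_inner (conj_transpose A *v x) y"
proof -
  have "herm_inner x (A *v y) = (\<Sum>i\<in>UNIV. \<Sum>j\<in>UNIV. cnj (x $ i) * (A $ i $ j * y $ j))"
    by (simp add: herm_inner_def matrix_vector_mult_def sum_distrib_left)
  also have "\<dots> = (\<Sum>j\<in>UNIV. \<Sum>i\<in>UNIV. cnj (x $ i) * (A $ i $ j * y $ j))"
    by (rule sum.swap)
  also have "\<dots> = herm_inner (conj_transpose A *v x) y"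
    by (simp add: herm_inner_def matrix_vector_mult_def conj_transpose_def sum_distrib_left
        sum_distrib_right mult_ac)
  finally show ?thesis .
qed

lemma inner_adjoint: "x \<bullet> (A *v y) = (conj_transpose A *v x) \<bullet> y"
  for x :: "complex^'n" and A :: "complex^'n^'n"
  by (metis Re_herm_inner herm_inner_adjoint)

lemma matrix_mult_add_right: "(A + B) ** C = A ** C + B ** C"
  for A B :: "'a::semiring_1^'n^'m"
  by (simp add: matrix_matrix_mult_def vec_eq_iff distrib_right sum.distrib)

lemma inner_matrix_eq_Re_trace: "A \<bullet> B = Re (trace (conj_transpose A ** B))"
  for A B :: "complex^'n^'n"
proof -
  have "A \<bullet> B = (\<Sum>i\<in>UNIV. \<Sum>j\<in>UNIV. Re (cnj (A $ i $ j) * B $ i $ j))"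
    by (simp add: inner_vec_def inner_complex_def)
  also have "\<dots> = (\<Sum>j\<in>UNIV. \<Sum>i\<in>UNIV. Re (cnj (A $ i $ j) * B $ i $ j))"
    by (rule sum.swap)
  also have "\<dots> = Re (trace (conj_transpose A ** B))"
    by (simp add: trace_def conj_transpose_def matrix_matrix_mult_def)
  finally show ?thesis .
qed

lemma herm_inner_axis_matrix: "herm_inner (axis i a) (A *v axis j b) = cnj a * A $ i $ j * b"
proof -
  have "(A *v axis j b) $ i = A $ i $ j * b" for i
    by (simp add: matrix_vector_mult_def axis_def if_distrib[of "\<lambda>u. _ * u"] cong: if_cong)
  then show ?thesis
    by (simp add: herm_inner_def axis_def if_distrib[of cnj] if_distrib[of "\<lambda>u. u * _"] cong: if_cong)
qed

text \<open>Over \<open>\<complex>\<close> the quadratic form determines the matrix: the vectors \<open>e\<^sub>i + e\<^sub>j\<close> and \<open>e\<^sub>i + \<i> e\<^sub>j\<close>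
  give the sum and the difference of the entries at \<open>(i, j)\<close> and \<open>(j, i)\<close>.\<close>

lemma sesq_form_eq_0_imp:
  assumes "\<And>x. sesq_form A x = 0"
  shows "A = 0"
proof -
  have *: "herm_inner x (A *v y) + herm_inner y (A *v x) = 0" for x y
    using assms[of "x + y"] assms[of x] assms[of y]
    by (simp add: sesq_form_eq_herm_inner matrix_vector_right_distrib herm_inner_add_left
        herm_inner_add_right algebra_simps)
  have "A $ i $ j = 0" for i j
    using *[of "axis i 1" "axis j 1"] *[of "axis i 1" "axis j \<i>"]
    by (simp add: herm_inner_axis_matrix complex_eq_iff)
  then show ?thesis by (simp add: vec_eq_iff)
qed

lemma hermitian_if_form_real:
  assumes "\<And>x. Im (sesq_form A x) = 0"
  shows "hermitian_matrix A"
proof -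
  have "sesq_form (A - conj_transpose A) x = 0" for x
  proof -
    have "herm_inner x (conj_transpose A *v x) = cnj (herm_inner x (A *v x))"
      by (simp add: herm_inner_adjoint cnj_herm_inner)
    then show ?thesis
      using assms[of x]
      by (simp add: sesq_form_eq_herm_inner matrix_vector_mult_diff_rdistrib
          herm_inner_diff_right complex_eq_iff)
  qed
  then show ?thesis
    using sesq_form_eq_0_imp[of "A - conj_transpose A"] by (simp add: hermitian_matrix_def)
qed

section \<open>The unitary group\<close>

lemma unitary_group_iff: "U \<in> unitary_group \<longleftrightarrow> conj_transpose U ** U = mat 1"
  by (auto simp: unitary_group_def matrix_left_right_inverse)

lemma unitary_conj_transpose: "U \<in> unitary_group \<Longrightarrow> conj_transpose U \<in> unitary_group"
  by (simp add: unitary_group_def)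

lemma unitary_mult: "U \<in> unitary_group \<Longrightarrow> V \<in> unitary_group \<Longrightarrow> U ** V \<in> unitary_group"
  unfolding unitary_group_iff
  by (metis conj_transpose_mult matrix_mul_assoc matrix_mul_lid)

lemma norm_unitary: "U \<in> unitary_group \<Longrightarrow> norm (U *v x) = norm x"
  by (simp add: unitary_group_iff norm_eq_sqrt_inner inner_adjoint matrix_vector_mul_assoc)

lemma compact_unitary_group: "compact (unitary_group :: (complex^'n^'n) set)"
proof (rule compact_eq_bounded_closed[THEN iffD2], intro conjI)
  have "norm U \<le> sqrt CARD('n)" if "U \<in> unitary_group" for U :: "complex^'n^'n"
  proof -
    have "trace (mat 1 :: complex^'n^'n) = of_nat CARD('n)"
      by (simp add: trace_def mat_def)
    then show ?thesis
      using that by (simp add: unitary_group_iff norm_eq_sqrt_inner inner_matrix_eq_Re_trace)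
  qed
  then show "bounded (unitary_group :: (complex^'n^'n) set)"
    unfolding bounded_iff by blast
next
  have "(unitary_group :: (complex^'n^'n) set) =
      {U. \<forall>i j. (\<Sum>k\<in>UNIV. cnj (U $ k $ i) * U $ k $ j) = (if i = j then 1 else 0)}"
    unfolding set_eq_iff unitary_group_iff
    by (simp add: vec_eq_iff matrix_matrix_mult_def conj_transpose_def mat_def)
  also have "closed \<dots>"
    by (intro closed_Collect_all closed_Collect_eq continuous_intros)
  finally show "closed (unitary_group :: (complex^'n^'n) set)" .
qed

text \<open>With \<open>k = (c - 1) / |x|\<^sup>2\<close> and \<open>|c| = 1\<close>, this is the matrix that multiplies \<open>x\<close> by \<open>c\<close> and
  fixes the orthogonal complement of \<open>x\<close>.\<close>

definition rank_one_perturbation :: "complex \<Rightarrow> complex^'n \<Rightarrow> complex^'n^'n" where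
  "rank_one_perturbation k x = mat 1 + (\<chi> i j. k * x $ i * cnj (x $ j))"

lemma rank_one_perturbation_mult_vec:
  "rank_one_perturbation k x *v y = y + (k * herm_inner x y) *s x"
proof -
  have "(\<chi> i j. k * x $ i * cnj (x $ j)) *v y = (k * herm_inner x y) *s x"
    by (simp add: vec_eq_iff matrix_vector_mult_def herm_inner_def sum_distrib_left
        sum_distrib_right mult_ac)
  then show ?thesis
    by (simp add: rank_one_perturbation_def matrix_vector_mult_add_rdistrib)
qed

lemma conj_transpose_rank_one_perturbation:
  "conj_transpose (rank_one_perturbation k x) = rank_one_perturbation (cnj k) x"
  by (auto simp: rank_one_perturbation_def conj_transpose_def vec_eq_iff mat_def)

lemma rank_one_perturbation_unitary:
  assumes "k + cnj k + cnj k * k * herm_inner x x = 0"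
  shows "rank_one_perturbation k x \<in> unitary_group"
proof -
  have "rank_one_perturbation (cnj k) x *v (rank_one_perturbation k x *v y) = y" for y
  proof -
    have "herm_inner x (c *s x) = c * herm_inner x x" for c
      by (simp add: herm_inner_def sum_distrib_left mult_ac)
    then have "rank_one_perturbation (cnj k) x *v (rank_one_perturbation k x *v y) =
        y + (herm_inner x y * (k + cnj k + cnj k * k * herm_inner x x)) *s x"
      by (simp add: rank_one_perturbation_mult_vec herm_inner_add_right vec_eq_iff algebra_simps)
    then show ?thesis using assms by simp
  qed
  then show ?thesis
    by (simp add: unitary_group_iff conj_transpose_rank_one_perturbation matrix_eq
        matrix_vector_mul_assoc)
qed

lemma trace_rank_one_perturbation_mult:
  "trace (rank_one_perturbation k x ** A) = trace A + k * sesq_form A x"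
proof -
  have "trace (rank_one_perturbation k x ** A) =
      trace A + (\<Sum>i\<in>UNIV. \<Sum>j\<in>UNIV. k * x $ i * cnj (x $ j) * A $ j $ i)"
    by (simp add: rank_one_perturbation_def matrix_mult_add_right trace_add)
       (simp add: trace_def matrix_matrix_mult_def)
  also have "(\<Sum>i\<in>UNIV. \<Sum>j\<in>UNIV. k * x $ i * cnj (x $ j) * A $ j $ i) =
      (\<Sum>j\<in>UNIV. \<Sum>i\<in>UNIV. k * x $ i * cnj (x $ j) * A $ j $ i)"
    by (rule sum.swap)
  also have "\<dots> = k * sesq_form A x"
    by (simp add: sesq_form_def matrix_vector_mult_def sum_distrib_left mult_ac)
  finally show ?thesis .
qed

section \<open>Polar decomposition\<close>

text \<open>The test matrix \<open>V\<close> multiplies \<open>x\<close> by the phase of \<open>w = \<langle>x, P x\<rangle>\<close>; it changes the trace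
  by \<open>(|w| - w) / |x|\<^sup>2\<close>, and this has nonpositive real part only if \<open>w = |w|\<close>.\<close>

lemma pos_semidef_if_trace_maximal:
  assumes max: "\<And>V. V \<in> unitary_group \<Longrightarrow> Re (trace (conj_transpose V ** P)) \<le> Re (trace P)"
  shows "pos_semidef P"
proof -
  have form: "sesq_form P x = complex_of_real (norm (sesq_form P x))" for x
  proof (cases "sesq_form P x = 0")
    case False
    define w where "w = sesq_form P x"
    define s where "s = (norm x)\<^sup>2"
    define c where "c = w / complex_of_real (norm w)"
    define k where "k = (c - 1) / complex_of_real s"
    have w: "w \<noteq> 0" using False by (simp add: w_def)
    have "x \<noteq> 0"
      using False by (auto simp: sesq_form_def)
    then have s: "s > 0" by (simp add: s_def)
    have cc: "cnj c * c = 1"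
      using w by (simp add: c_def complex_norm_square[symmetric] power2_eq_square mult.commute)
    have cw: "cnj c * w = complex_of_real (norm w)"
      using w by (simp add: c_def complex_norm_square[symmetric] power2_eq_square mult.commute)
    have "k + cnj k + cnj k * k * complex_of_real s = (cnj c * c - 1) / complex_of_real s"
      using s by (simp add: k_def field_simps)
    then have "rank_one_perturbation k x \<in> unitary_group"
      by (intro rank_one_perturbation_unitary) (simp add: herm_inner_self cc flip: s_def)
    from max[OF this] have "Re (cnj k * w) \<le> 0"
      by (simp add: conj_transpose_rank_one_perturbation trace_rank_one_perturbation_mult w_def)
    moreover have "cnj k * w = (complex_of_real (norm w) - w) / complex_of_real s"
      using cw by (simp add: k_def algebra_simps)
    ultimately have "norm w \<le> Re w"
      using s by (simp add: divide_le_0_iff)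
    then have "Re w = norm w"
      using complex_Re_le_cmod[of w] by linarith
    moreover from this have "Im w = 0"
      using cmod_power2[of w] by simp
    ultimately show ?thesis
      by (simp add: complex_eq_iff flip: w_def)
  qed simp
  have "Im (sesq_form P x) = 0" for x
    by (subst form) simp
  moreover have "0 \<le> Re (sesq_form P x)" for x
    by (subst form) simp
  ultimately show ?thesis
    by (simp add: pos_semidef_def hermitian_if_form_real)
qed

theorem polar_decomposition:
  fixes Z :: "complex^'n^'n"
  obtains U where "U \<in> unitary_group" and "pos_semidef (conj_transpose U ** Z)"
proof -
  have "mat 1 \<in> (unitary_group :: (complex^'n^'n) set)"
    by (simp add: unitary_group_iff)
  then have "(unitary_group :: (complex^'n^'n) set) \<noteq> {}"
    by blast
  moreover have "continuous_on unitary_group (\<lambda>W. W \<bullet> Z)"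
    by (intro continuous_intros)
  ultimately obtain U :: "complex^'n^'n" where U: "U \<in> unitary_group"
    and max: "\<And>W. W \<in> unitary_group \<Longrightarrow> W \<bullet> Z \<le> U \<bullet> Z"
    using continuous_attains_sup[OF compact_unitary_group] by metis
  have "pos_semidef (conj_transpose U ** Z)"
  proof (rule pos_semidef_if_trace_maximal)
    fix V :: "complex^'n^'n"
    assume "V \<in> unitary_group"
    from max[OF unitary_mult[OF U this]]
    show "Re (trace (conj_transpose V ** (conj_transpose U ** Z))) \<le>
        Re (trace (conj_transpose U ** Z))"
      by (simp add: inner_matrix_eq_Re_trace conj_transpose_mult matrix_mul_assoc)
  qed
  with U that show thesis by blast
qed

section \<open>Uniqueness of the positive square root\<close>

text \<open>Moving from a zero \<open>x\<close> of the form in the direction \<open>- P x\<close> would decrease it below zero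
  to first order.\<close>

lemma pos_semidef_form_0_imp:
  assumes P: "pos_semidef P" and "Re (sesq_form P x) = 0"
  shows "P *v x = 0"
proof -
  define y where "y = P *v x"
  define q where "q = y \<bullet> (P *v y)"
  have herm: "conj_transpose P = P"
    using P by (simp add: pos_semidef_def hermitian_matrix_def)
  have nonneg: "0 \<le> z \<bullet> (P *v z)" for z
    using P by (simp add: pos_semidef_def sesq_form_eq_herm_inner Re_herm_inner)
  have x0: "x \<bullet> y = 0"
    using assms(2) by (simp add: sesq_form_eq_herm_inner Re_herm_inner y_def)
  have "P *v (t *\<^sub>R z) = t *\<^sub>R (P *v z)" for t z
    by (simp add: vec_eq_iff matrix_vector_mult_def scaleR_sum_right)
  then have lin: "P *v (x - t *\<^sub>R y) = y - t *\<^sub>R (P *v y)" for t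
    by (simp add: y_def matrix_vector_mult_diff_distrib)
  have xy: "x \<bullet> (P *v y) = y \<bullet> y"
    using inner_adjoint[of x P y] by (simp add: herm flip: y_def)
  have quad: "0 \<le> t * t * q - 2 * t * (y \<bullet> y)" for t
  proof -
    have "(x - t *\<^sub>R y) \<bullet> (y - t *\<^sub>R (P *v y)) = t * t * q - 2 * t * (y \<bullet> y)"
      by (simp add: inner_diff_left inner_diff_right x0 xy q_def right_diff_distrib)
    then show ?thesis
      using nonneg[of "x - t *\<^sub>R y"] by (simp only: lin)
  qed
  have "q \<ge> 0" using nonneg by (simp add: q_def)
  (* For small positive t the linear term of quad dominates; t = (y . y) / (1 + q) is small
     enough. *)
  have "y \<bullet> y = 0"
  proof (rule ccontr)
    assume "y \<bullet> y \<noteq> 0"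
    then have pos: "y \<bullet> y > 0" by simp
    define t where "t = (y \<bullet> y) / (1 + q)"
    have t: "t > 0" using pos \<open>q \<ge> 0\<close> by (simp add: t_def)
    have tq: "t * q \<le> y \<bullet> y"
      using pos \<open>q \<ge> 0\<close> by (simp add: t_def field_simps)
    have "t * q - 2 * (y \<bullet> y) < 0"
      using tq pos by linarith
    with t have "t * (t * q - 2 * (y \<bullet> y)) < 0"
      by (rule mult_pos_neg)
    then show False
      using quad[of t] by (simp add: algebra_simps)
  qed
  then show ?thesis by (simp add: y_def)
qed

theorem pos_semidef_root_unique:
  fixes P Q :: "complex^'n^'n"
  assumes P: "pos_semidef P" and Q: "pos_semidef Q" and eq: "P ** P = Q ** Q"
  shows "P = Q"
proof -
  define D where "D = P - Q"
  define S where "S = P + Q"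
  have herm: "conj_transpose P = P" "conj_transpose Q = Q"
    using P Q by (auto simp: pos_semidef_def hermitian_matrix_def)
  then have hD: "conj_transpose D = D"
    by (simp add: D_def conj_transpose_diff)
  have diff_r: "A ** (B - C) = A ** B - A ** C" for A B C :: "complex^'n^'n"
    by (simp add: matrix_matrix_mult_def vec_eq_iff algebra_simps sum_subtractf)
  have diff_l: "(A - B) ** C = A ** C - B ** C" for A B C :: "complex^'n^'n"
    by (simp add: matrix_matrix_mult_def vec_eq_iff algebra_simps sum_subtractf)
  have anti: "S ** D + D ** S = 0"
    using eq by (simp add: S_def D_def diff_l diff_r matrix_add_ldistrib matrix_mult_add_right)
  have "D ** S ** D + D ** (D ** S) = 0"
    using arg_cong[OF anti, of "\<lambda>M. D ** M"] by (simp add: matrix_add_ldistrib matrix_mul_assoc)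
  moreover have "trace (D ** (D ** S)) = trace (D ** S ** D)"
    by (rule trace_mul_sym)
  ultimately have "2 * trace (D ** S ** D) = 0"
    by (metis mult_2 trace_0 trace_add mat_0)
  then have tr0: "trace (D ** S ** D) = 0" by simp
  have entry: "(D ** S ** D) $ i $ i = sesq_form P (D *v axis i 1) + sesq_form Q (D *v axis i 1)"
    for i
  proof -
    have "(D ** S ** D) $ i $ i = herm_inner (axis i 1) (D *v (S *v (D *v axis i 1)))"
      by (simp add: matrix_vector_mul_assoc herm_inner_axis_matrix matrix_mul_assoc)
    also have "\<dots> = herm_inner (D *v axis i 1) (S *v (D *v axis i 1))"
      by (simp only: herm_inner_adjoint[of "axis i 1" D] hD)
    finally show ?thesis
      by (simp add: sesq_form_eq_herm_inner S_def matrix_vector_mult_add_rdistrib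
          herm_inner_add_right)
  qed
  have nonneg: "0 \<le> Re (sesq_form P x)" "0 \<le> Re (sesq_form Q x)" for x
    using P Q by (auto simp: pos_semidef_def)
  have "(\<Sum>i\<in>UNIV. Re (sesq_form P (D *v axis i 1)) + Re (sesq_form Q (D *v axis i 1))) = 0"
    using arg_cong[OF tr0, of Re] by (simp add: trace_def entry)
  then have "Re (sesq_form P (D *v axis i 1)) + Re (sesq_form Q (D *v axis i 1)) = 0" for i
    by (subst (asm) sum_nonneg_eq_0_iff) (auto simp: nonneg)
  then have zero: "Re (sesq_form P (D *v axis i 1)) = 0" "Re (sesq_form Q (D *v axis i 1)) = 0" for i
    using nonneg[of "D *v axis i 1"] by (smt (verit))+
  have "D *v axis i 1 = 0" for i
  proof -
    have "D *v (D *v axis i 1) = P *v (D *v axis i 1) - Q *v (D *v axis i 1)"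
      by (simp add: D_def matrix_vector_mult_diff_rdistrib)
    also have "\<dots> = 0"
      using zero[of i] P Q by (simp add: pos_semidef_form_0_imp)
    finally have "(D *v axis i 1) \<bullet> (D *v axis i 1) = 0"
      by (simp add: inner_adjoint[of "D *v axis i 1" D] hD)
    then show ?thesis by simp
  qed
  then have "D $ i $ j = 0" for i j
    using herm_inner_axis_matrix[of i 1 D j 1] by (simp add: herm_inner_def)
  then show ?thesis
    by (simp add: D_def vec_eq_iff)
qed

lemma matrix_sqrt_eqI:
  assumes "pos_semidef P" and "P ** P = A"
  shows "matrix_sqrt A = P"
  unfolding matrix_sqrt_def using assms
  by (intro the_equality) (auto intro: pos_semidef_root_unique)

lemma matrix_sqrt_left:
  assumes U: "U \<in> unitary_group" and P: "pos_semidef (conj_transpose U ** Z)"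
  shows "matrix_sqrt (conj_transpose Z ** Z) = conj_transpose U ** Z"
proof (rule matrix_sqrt_eqI[OF P])
  have "conj_transpose (conj_transpose U ** Z) = conj_transpose U ** Z"
    using P by (simp add: pos_semidef_def hermitian_matrix_def)
  then have "conj_transpose U ** Z ** (conj_transpose U ** Z) =
      conj_transpose (conj_transpose U ** Z) ** (conj_transpose U ** Z)"
    by simp
  also have "\<dots> = conj_transpose Z ** (U ** conj_transpose U) ** Z"
    by (simp add: conj_transpose_mult matrix_mul_assoc)
  finally show "conj_transpose U ** Z ** (conj_transpose U ** Z) = conj_transpose Z ** Z"
    using U by (simp add: unitary_group_def)
qed

text \<open>If \<open>Z = U P\<close> then \<open>Z U\<^sup>* = U P U\<^sup>*\<close>, which is positive semidefinite with square \<open>Z Z\<^sup>*\<close>.\<close>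

lemma matrix_sqrt_right:
  assumes U: "U \<in> unitary_group" and P: "pos_semidef (conj_transpose U ** Z)"
  shows "matrix_sqrt (Z ** conj_transpose Z) = Z ** conj_transpose U"
proof (rule matrix_sqrt_eqI)
  let ?P = "conj_transpose U ** Z"
  have UU: "U ** conj_transpose U = mat 1" "conj_transpose U ** U = mat 1"
    using U by (auto simp: unitary_group_def)
  have herm: "conj_transpose ?P = ?P"
    using P by (simp add: pos_semidef_def hermitian_matrix_def)
  have eq: "Z ** conj_transpose U = U ** ?P ** conj_transpose U"
    by (simp add: matrix_mul_assoc UU)
  have hZ: "conj_transpose (Z ** conj_transpose U) = Z ** conj_transpose U"
    unfolding eq by (simp only: conj_transpose_mult[of _ "conj_transpose U"]
        conj_transpose_mult[of U ?P] herm) (simp add: matrix_mul_assoc)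
  have "sesq_form (Z ** conj_transpose U) x = sesq_form ?P (conj_transpose U *v x)" for x
  proof -
    have "sesq_form (Z ** conj_transpose U) x =
        herm_inner x (U *v (?P *v (conj_transpose U *v x)))"
      unfolding eq sesq_form_eq_herm_inner by (simp add: matrix_vector_mul_assoc matrix_mul_assoc)
    then show ?thesis
      by (simp only: herm_inner_adjoint[of x U] sesq_form_eq_herm_inner)
  qed
  with hZ P show "pos_semidef (Z ** conj_transpose U)"
    by (simp add: pos_semidef_def hermitian_matrix_def)
  have "Z ** conj_transpose U ** (Z ** conj_transpose U) =
      Z ** conj_transpose U ** conj_transpose (Z ** conj_transpose U)"
    by (simp only: hZ)
  also have "\<dots> = Z ** (conj_transpose U ** U) ** conj_transpose Z"
    by (simp add: conj_transpose_mult matrix_mul_assoc)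
  finally show "Z ** conj_transpose U ** (Z ** conj_transpose U) = Z ** conj_transpose Z"
    by (simp add: UU)
qed

section \<open>Unitary invariance of symbols\<close>

lemma cartan_domain_I_iff: "Z \<in> cartan_domain_I \<longleftrightarrow> (\<forall>x. x \<noteq> 0 \<longrightarrow> norm (Z *v x) < norm x)"
proof -
  have "hermitian_matrix (mat 1 - conj_transpose Z ** Z)"
    by (simp add: hermitian_matrix_def conj_transpose_diff conj_transpose_mult)
  moreover have "Re (sesq_form (mat 1 - conj_transpose Z ** Z) x) = (norm x)\<^sup>2 - (norm (Z *v x))\<^sup>2"
    for x
  proof -
    have "x \<bullet> (conj_transpose Z *v (Z *v x)) = (Z *v x) \<bullet> (Z *v x)"
      by (simp add: inner_adjoint)
    then show ?thesis
      by (simp add: sesq_form_eq_herm_inner Re_herm_inner matrix_vector_mult_diff_rdistrib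
          inner_diff_right power2_norm_eq_inner matrix_vector_mul_assoc)
  qed
  moreover have "(norm (Z *v x))\<^sup>2 < (norm x)\<^sup>2 \<longleftrightarrow> norm (Z *v x) < norm x" for x
    using power_mono_iff[of "norm x" "norm (Z *v x)" 2] by (simp add: not_le[symmetric])
  ultimately show ?thesis
    by (simp add: cartan_domain_I_def loewner_less_def pos_def_def)
qed

lemma cartan_domain_I_unitary_left:
  "U \<in> unitary_group \<Longrightarrow> Z \<in> cartan_domain_I \<Longrightarrow> U ** Z \<in> cartan_domain_I"
  by (simp add: cartan_domain_I_iff norm_unitary flip: matrix_vector_mul_assoc)

lemma cartan_domain_I_unitary_right:
  fixes Z V :: "complex^'n^'n"
  assumes "V \<in> unitary_group" "Z \<in> cartan_domain_I"
  shows "Z ** V \<in> cartan_domain_I"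
  unfolding cartan_domain_I_iff
proof (intro allI impI)
  fix x :: "complex^'n"
  assume "x \<noteq> 0"
  then have "V *v x \<noteq> 0"
    using norm_unitary[OF assms(1), of x] by auto
  then show "norm ((Z ** V) *v x) < norm x"
    using assms norm_unitary[OF assms(1), of x]
    by (metis cartan_domain_I_iff matrix_vector_mul_assoc)
qed

lemma left_invariant_iff:
  fixes a :: "complex^'n^'n \<Rightarrow> 'b"
  shows "(\<forall>U\<in>unitary_group. \<forall>Z\<in>cartan_domain_I. a (U ** Z) = a Z) \<longleftrightarrow>
    (\<forall>Z\<in>cartan_domain_I. a Z = a (matrix_sqrt (conj_transpose Z ** Z)))"
proof (intro iffI ballI)
  fix Z :: "complex^'n^'n"
  assume inv: "\<forall>U\<in>unitary_group. \<forall>Z\<in>cartan_domain_I. a (U ** Z) = a Z" and Z: "Z \<in> cartan_domain_I"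
  obtain U where U: "U \<in> unitary_group" and P: "pos_semidef (conj_transpose U ** Z)"
    by (rule polar_decomposition)
  show "a Z = a (matrix_sqrt (conj_transpose Z ** Z))"
    using inv Z unitary_conj_transpose[OF U] by (simp add: matrix_sqrt_left[OF U P])
next
  fix U Z :: "complex^'n^'n"
  assume "\<forall>Z\<in>cartan_domain_I. a Z = a (matrix_sqrt (conj_transpose Z ** Z))"
    and U: "U \<in> unitary_group" and "Z \<in> cartan_domain_I"
  moreover have "conj_transpose (U ** Z) ** (U ** Z) = conj_transpose Z ** (conj_transpose U ** U) ** Z"
    by (simp add: conj_transpose_mult matrix_mul_assoc)
  ultimately show "a (U ** Z) = a Z"
    using cartan_domain_I_unitary_left by (metis matrix_mul_rid unitary_group_iff)
qed

lemma right_invariant_iff: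
  fixes a :: "complex^'n^'n \<Rightarrow> 'b"
  shows "(\<forall>V\<in>unitary_group. \<forall>Z\<in>cartan_domain_I. a (Z ** V) = a Z) \<longleftrightarrow>
    (\<forall>Z\<in>cartan_domain_I. a Z = a (matrix_sqrt (Z ** conj_transpose Z)))"
proof (intro iffI ballI)
  fix Z :: "complex^'n^'n"
  assume inv: "\<forall>V\<in>unitary_group. \<forall>Z\<in>cartan_domain_I. a (Z ** V) = a Z" and Z: "Z \<in> cartan_domain_I"
  obtain U where U: "U \<in> unitary_group" and P: "pos_semidef (conj_transpose U ** Z)"
    by (rule polar_decomposition)
  show "a Z = a (matrix_sqrt (Z ** conj_transpose Z))"
    using inv Z unitary_conj_transpose[OF U] by (simp add: matrix_sqrt_right[OF U P])
next
  fix V Z :: "complex^'n^'n"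
  assume "\<forall>Z\<in>cartan_domain_I. a Z = a (matrix_sqrt (Z ** conj_transpose Z))"
    and V: "V \<in> unitary_group" and "Z \<in> cartan_domain_I"
  moreover have "Z ** V ** conj_transpose (Z ** V) = Z ** (V ** conj_transpose V) ** conj_transpose Z"
    by (simp add: conj_transpose_mult matrix_mul_assoc)
  moreover have "V ** conj_transpose V = mat 1"
    using V by (simp add: unitary_group_def)
  ultimately show "a (Z ** V) = a Z"
    using cartan_domain_I_unitary_right by (metis matrix_mul_rid)
qed

theorem corollary3p11:
  shows "(Linf_left_inv :: (complex^'n^'n \<Rightarrow> complex) set set) =
      {c \<in> Linf. \<exists>a\<in>c. \<forall>Z\<in>cartan_domain_I. a Z = a (matrix_sqrt (conj_transpose Z ** Z))}
    \<and> (Linf_right_inv :: (complex^'n^'n \<Rightarrow> complex) set set) =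
      {c \<in> Linf. \<exists>a\<in>c. \<forall>Z\<in>cartan_domain_I. a Z = a (matrix_sqrt (Z ** conj_transpose Z))}"
  by (simp add: Linf_left_inv_def Linf_right_inv_def left_invariant_iff right_invariant_iff)

end
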